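(* Let $G$ be a finitely generated group in which every infinite normal subgroup has trivial centralizer. Then every infinite commensurated relatively residually finite subgroup of $G$ has an infinite intersection with every non-trivial normal subgroup of $G$.
   Context: A subgroup $H$ of a group $G$ is commensurated if $[H : H \cap gHg^{-1}] < \infty$ for all $g \in G$. Let $\mathcal{N}(G,H)$ be the set of normal subgroups of $G$ that contain a finite index subgroup of $H$. The subgroup $H$ is relatively residually finite in $G$ if $\bigcap_{M \in \mathcal{N}(G,H)} M = \{1\}$. *)

theory Defs
  imports "HOL-Algebra.Generated_Groups"
begin

definition finitely_generated_group :: "('a, 'b) monoid_scheme \<Rightarrow> bool" where
  "finitely_generated_group G \<longleftrightarrow>
     group G \<and> (\<exists>S. finite S \<and> S \<subseteq> carrier G \<and> generate G S = carrier G)"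

definition centralizer :: "('a, 'b) monoid_scheme \<Rightarrow> 'a set \<Rightarrow> 'a set" where
  "centralizer G N = {g \<in> carrier G. \<forall>x\<in>N. g \<otimes>\<^bsub>G\<^esub> x = x \<otimes>\<^bsub>G\<^esub> g}"

text \<open>Finite index is finiteness of the coset space itself, since the
  cardinality \<open>card (rcosets\<^bsub>G\<^esub> K)\<close> is \<open>0\<close> when there are infinitely many cosets.\<close>

definition finite_index_subgroup :: "'a set \<Rightarrow> ('a, 'b) monoid_scheme \<Rightarrow> bool" where
  "finite_index_subgroup K G \<longleftrightarrow> subgroup K G \<and> finite (rcosets\<^bsub>G\<^esub> K)"

definition commensurated :: "'a set \<Rightarrow> ('a, 'b) monoid_scheme \<Rightarrow> bool" where
  "commensurated H G \<longleftrightarrow> subgroup H G \<and>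
     (\<forall>g\<in>carrier G.
        finite_index_subgroup (H \<inter> (g <#\<^bsub>G\<^esub> H #>\<^bsub>G\<^esub> inv\<^bsub>G\<^esub> g)) (G\<lparr>carrier := H\<rparr>))"

definition normal_virtually_containing ::
    "('a, 'b) monoid_scheme \<Rightarrow> 'a set \<Rightarrow> 'a set set" where
  "normal_virtually_containing G H =
     {M. M \<lhd> G \<and> (\<exists>K. finite_index_subgroup K (G\<lparr>carrier := H\<rparr>) \<and> K \<subseteq> M)}"

definition relatively_residually_finite :: "'a set \<Rightarrow> ('a, 'b) monoid_scheme \<Rightarrow> bool" where
  "relatively_residually_finite H G \<longleftrightarrow>
     subgroup H G \<and> \<Inter>(normal_virtually_containing G H) = {\<one>\<^bsub>G\<^esub>}"

end

theory Submission
  imports Defs "HOL-Algebra.Group_Action"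
begin

text \<open>
  Let \<open>H\<close> be commensurated and relatively residually finite in \<open>G\<close>, and give \<open>G\<close> the Hausdorff group
  topology in which the members of \<open>normal_virtually_containing G H\<close> form a base of neighbourhoods
  of the identity. Let \<open>R\<close> be the closure of \<open>H\<close>. For each \<open>s\<close>, \<open>H\<close> is covered by finitely many cosets
  of \<open>D = s H s\<inverse>\<close>, so \<open>R\<close> is covered by the closures of these cosets; a small enough \<open>M\<close> misses those
  closed cosets that do not contain the identity, whence \<open>M \<inter> R\<close> lies in the closure of \<open>D\<close>, which is
  \<open>s R s\<inverse>\<close>. Letting \<open>s\<close> run through a finite generating set gives an \<open>M\<close> such that \<open>M \<inter> R\<close> is normal
  in \<open>G\<close>.

  Suppose now that \<open>N\<close> is normal and \<open>H \<inter> N\<close> is finite. Every \<open>n \<in> N\<close> has only finitely many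
  conjugates under \<open>H\<close>, and since finite sets are closed, \<open>n\<close> has no further conjugates under \<open>R\<close>.
  Hence the commutators of \<open>n\<close> with elements of \<open>R\<close> form a finite set, and a small enough \<open>M'\<close>
  contains none of them but the identity. So \<open>n\<close> centralizes the infinite normal subgroup
  \<open>M' \<inter> M \<inter> R\<close>, and therefore \<open>n = 1\<close>.
\<close>

lemma (in group) inv_mult_cancel_left:
  assumes "x \<in> carrier G" "y \<in> carrier G"
  shows "x \<otimes> (inv x \<otimes> y) = y" "inv x \<otimes> (x \<otimes> y) = y"
  using assms by (simp_all add: m_assoc[symmetric])

section \<open>The group topology given by a filter base of normal subgroups\<close>

locale normal_filter_base = group G for G (structure) +
  fixes \<B> :: "'a set set"
  assumes base_normal: "M \<in> \<B> \<Longrightarrow> M \<lhd> G"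
    and base_nonempty: "\<B> \<noteq> {}"
    and base_Int: "M \<in> \<B> \<Longrightarrow> M' \<in> \<B> \<Longrightarrow> M \<inter> M' \<in> \<B>"
begin

text \<open>For \<open>X\<close> inside the carrier this is the topological closure, the
  intersection of the sets XM over all M in \<open>\<B>\<close>.\<close>

definition cl :: "'a set \<Rightarrow> 'a set" where
  "cl X = {x \<in> carrier G. \<forall>M\<in>\<B>. \<exists>y\<in>X. inv y \<otimes> x \<in> M}"

lemma base_subgroup: "M \<in> \<B> \<Longrightarrow> subgroup M G"
  using base_normal normal_imp_subgroup by blast

lemma base_conj: "M \<in> \<B> \<Longrightarrow> x \<in> carrier G \<Longrightarrow> m \<in> M \<Longrightarrow> x \<otimes> m \<otimes> inv x \<in> M"
  by (rule normal.inv_op_closed2[OF base_normal])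

lemma cl_carrier: "cl X \<subseteq> carrier G"
  by (auto simp: cl_def)

lemma cl_mono: "X \<subseteq> Y \<Longrightarrow> cl X \<subseteq> cl Y"
  by (fastforce simp: cl_def)

lemma subset_cl:
  assumes "X \<subseteq> carrier G"
  shows "X \<subseteq> cl X"
proof
  fix x assume x: "x \<in> X"
  then have xc: "x \<in> carrier G" using assms by blast
  then have "inv x \<otimes> x \<in> M" if "M \<in> \<B>" for M
    using subgroup.one_closed[OF base_subgroup[OF that]] xc by simp
  then show "x \<in> cl X" using x xc unfolding cl_def by blast
qed

text \<open>Intersecting the members chosen for the single conditions stays in the base, and
  \<open>P\<close> passes to smaller sets. Every "small enough M" below is obtained from
  this.\<close>

lemma finite_choice_base:
  assumes "finite I"
    and "\<And>i. i \<in> I \<Longrightarrow> \<exists>M\<in>\<B>. P i M"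
    and "\<And>i M M'. i \<in> I \<Longrightarrow> P i M \<Longrightarrow> M' \<subseteq> M \<Longrightarrow> P i M'"
  shows "\<exists>M\<in>\<B>. \<forall>i\<in>I. P i M"
  using assms
proof (induction I rule: finite_induct)
  case empty
  then show ?case using base_nonempty by blast
next
  case (insert i I)
  have "\<exists>M\<in>\<B>. \<forall>j\<in>I. P j M"
    by (rule insert.IH) (auto intro: insert.prems)
  then obtain M where M: "M \<in> \<B>" "\<forall>j\<in>I. P j M" by blast
  obtain M' where M': "M' \<in> \<B>" "P i M'"
    using insert.prems(1) by blast
  have "P i (M \<inter> M')" using insert.prems(2)[OF _ M'(2)] by simp
  moreover have "\<forall>j\<in>I. P j (M \<inter> M')" using insert.prems(2) M(2) by (blast intro: insert.prems(2)[OF insertI2])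
  ultimately show ?case using base_Int[OF M(1) M'(1)] by blast
qed

text \<open>If some member of the base separates \<open>x\<close> from each of the finitely many
  sets, then one member separates it from all of them.\<close>

lemma cl_Union:
  assumes "finite \<Y>" "x \<in> cl (\<Union>\<Y>)"
  shows "\<exists>Y\<in>\<Y>. x \<in> cl Y"
proof (rule ccontr)
  assume neg: "\<not> ?thesis"
  have x: "x \<in> carrier G" using assms(2) by (simp add: cl_def)
  have "\<exists>M\<in>\<B>. \<forall>Y\<in>\<Y>. \<forall>y\<in>Y. inv y \<otimes> x \<notin> M"
    using neg x by (intro finite_choice_base[OF assms(1)]) (auto simp: cl_def)
  then show False using assms(2) by (auto simp: cl_def)
qed

text \<open>Trivial intersection of the base makes points closed, and finite unions of closed sets
  are closed.\<close>

lemma cl_finite: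
  assumes "\<Inter>\<B> = {\<one>}" "finite X" "X \<subseteq> carrier G"
  shows "cl X = X"
proof
  show "cl X \<subseteq> X"
  proof
    fix x assume x: "x \<in> cl X"
    then have "x \<in> cl (\<Union>((\<lambda>y. {y}) ` X))" by simp
    then obtain y where y: "y \<in> X" "x \<in> cl {y}"
      using cl_Union[of "(\<lambda>y. {y}) ` X" x] assms(2) by blast
    then have "inv y \<otimes> x \<in> \<Inter>\<B>" by (auto simp: cl_def)
    then have "inv y \<otimes> x = \<one>" using assms(1) by simp
    moreover have "x \<in> carrier G" "y \<in> carrier G" using x y assms(3) cl_carrier by auto
    ultimately have "x = y" by (metis inv_closed inv_inv inv_equality)
    then show "x \<in> X" using y by simp
  qed
qed (rule subset_cl[OF assms(3)])

lemma cl_subgroup: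
  assumes "subgroup X G"
  shows "subgroup (cl X) G"
proof (rule subgroupI)
  interpret X: subgroup X G by fact
  show "cl X \<subseteq> carrier G" by (rule cl_carrier)
  show "cl X \<noteq> {}" using subset_cl[OF X.subset] X.one_closed by blast
  fix a assume a: "a \<in> cl X"
  then have ac: "a \<in> carrier G" by (simp add: cl_def)
  show "inv a \<in> cl X"
    unfolding cl_def
  proof (safe, simp add: ac)
    fix M assume M: "M \<in> \<B>"
    interpret M: subgroup M G by (rule base_subgroup[OF M])
    obtain y where y: "y \<in> X" "inv y \<otimes> a \<in> M" using a M by (auto simp: cl_def)
    have yc: "y \<in> carrier G" using y X.subset by blast
    have "y \<otimes> inv (inv y \<otimes> a) \<otimes> inv y \<in> M" using base_conj[OF M yc] y by blast
    moreover have "y \<otimes> inv (inv y \<otimes> a) \<otimes> inv y = inv (inv y) \<otimes> inv a"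
      using ac yc by (simp add: inv_mult_group m_assoc)
    ultimately show "\<exists>y\<in>X. inv y \<otimes> inv a \<in> M" using y X.m_inv_closed by metis
  qed
  fix b assume b: "b \<in> cl X"
  then have bc: "b \<in> carrier G" by (simp add: cl_def)
  show "a \<otimes> b \<in> cl X"
    unfolding cl_def
  proof (safe, simp add: ac bc)
    fix M assume M: "M \<in> \<B>"
    interpret M: subgroup M G by (rule base_subgroup[OF M])
    obtain y where y: "y \<in> X" "inv y \<otimes> a \<in> M" using a M by (auto simp: cl_def)
    obtain z where z: "z \<in> X" "inv z \<otimes> b \<in> M" using b M by (auto simp: cl_def)
    have yc: "y \<in> carrier G" "z \<in> carrier G" using y z X.subset by blast+
    \<comment> \<open>Normality of \<open>M\<close> allows the error of \<open>a\<close> to be moved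
      past \<open>z\<close>, so that \<open>y \<otimes> z\<close> approximates
      \<open>a \<otimes> b\<close> modulo \<open>M\<close>.\<close>
    have "inv z \<otimes> (inv y \<otimes> a) \<otimes> inv (inv z) \<in> M" using base_conj[OF M, of "inv z"] y yc by blast
    then have "inv z \<otimes> (inv y \<otimes> a) \<otimes> inv (inv z) \<otimes> (inv z \<otimes> b) \<in> M" using z by blast
    moreover have "inv z \<otimes> (inv y \<otimes> a) \<otimes> inv (inv z) \<otimes> (inv z \<otimes> b) = inv (y \<otimes> z) \<otimes> (a \<otimes> b)"
      using ac bc yc by (simp add: inv_mult_group m_assoc inv_mult_cancel_left)
    ultimately show "\<exists>y\<in>X. inv y \<otimes> (a \<otimes> b) \<in> M" using y z X.m_closed by metis
  qed
qed

lemma cl_conj: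
  assumes "X \<subseteq> carrier G" "g \<in> carrier G" "x \<in> cl X"
  shows "g \<otimes> x \<otimes> inv g \<in> cl ((\<lambda>y. g \<otimes> y \<otimes> inv g) ` X)"
  unfolding cl_def
proof safe
  have xc: "x \<in> carrier G" using assms(3) cl_carrier by blast
  show "g \<otimes> x \<otimes> inv g \<in> carrier G" using assms(2) xc by simp
  fix M assume M: "M \<in> \<B>"
  obtain y where y: "y \<in> X" "inv y \<otimes> x \<in> M" using assms(3) M by (auto simp: cl_def)
  have yc: "y \<in> carrier G" using y assms(1) by blast
  have "g \<otimes> (inv y \<otimes> x) \<otimes> inv g \<in> M" using base_conj[OF M assms(2)] y by blast
  moreover have "g \<otimes> (inv y \<otimes> x) \<otimes> inv g = inv (g \<otimes> y \<otimes> inv g) \<otimes> (g \<otimes> x \<otimes> inv g)"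
    using assms(2) xc yc by (simp add: inv_mult_group m_assoc inv_mult_cancel_left)
  ultimately show "\<exists>y\<in>(\<lambda>y. g \<otimes> y \<otimes> inv g) ` X. inv y \<otimes> (g \<otimes> x \<otimes> inv g) \<in> M"
    using y by auto
qed

text \<open>This is continuity of x \<mapsto> x^-1 n x. If x = y m with m in M and p = y^-1 n y,
  then p^-1 (x^-1 n x) = (p^-1 m^-1 p) m lies in M by normality.\<close>

lemma conj_by_cl:
  assumes "X \<subseteq> carrier G" "n \<in> carrier G" "x \<in> cl X"
  shows "inv x \<otimes> n \<otimes> x \<in> cl ((\<lambda>y. inv y \<otimes> n \<otimes> y) ` X)"
  unfolding cl_def
proof safe
  have xc: "x \<in> carrier G" using assms(3) cl_carrier by blast
  show "inv x \<otimes> n \<otimes> x \<in> carrier G" using assms(2) xc by simp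
  fix M assume M: "M \<in> \<B>"
  interpret M: subgroup M G by (rule base_subgroup[OF M])
  obtain y where y: "y \<in> X" "inv y \<otimes> x \<in> M" using assms(3) M by (auto simp: cl_def)
  have yc: "y \<in> carrier G" using y assms(1) by blast
  define m where "m = inv y \<otimes> x"
  have m: "m \<in> M" "m \<in> carrier G" and x: "x = y \<otimes> m"
    using y yc xc by (auto simp: m_def m_assoc[symmetric])
  define p where "p = inv y \<otimes> n \<otimes> y"
  have pc: "p \<in> carrier G" using yc assms(2) by (simp add: p_def)
  have "inv p \<otimes> inv m \<otimes> inv (inv p) \<in> M" using base_conj[OF M, of "inv p" "inv m"] m pc by blast
  then have "inv p \<otimes> inv m \<otimes> inv (inv p) \<otimes> m \<in> M" using m by blast
  moreover have "inv p \<otimes> inv m \<otimes> inv (inv p) \<otimes> m = inv p \<otimes> (inv x \<otimes> n \<otimes> x)"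
    using m pc yc assms(2) by (simp add: p_def x inv_mult_group m_assoc)
  ultimately show "\<exists>z\<in>(\<lambda>y. inv y \<otimes> n \<otimes> y) ` X. inv z \<otimes> (inv x \<otimes> n \<otimes> x) \<in> M"
    using y(1) p_def by auto
qed

text \<open>The closure of a coset of \<open>D\<close> is a coset of \<open>cl D\<close>, and the
  only such coset through the identity is \<open>cl D\<close> itself.\<close>

lemma one_in_cl_coset:
  assumes "subgroup D G" "c \<in> carrier G" "\<one> \<in> cl (D #> c)" "x \<in> cl (D #> c)"
  shows "x \<in> cl D"
  unfolding cl_def
proof safe
  interpret D: subgroup D G by fact
  show xc: "x \<in> carrier G" using assms(4) cl_carrier by blast
  fix M assume M: "M \<in> \<B>"
  interpret M: subgroup M G by (rule base_subgroup[OF M])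
  obtain d where d: "d \<in> D" "inv (d \<otimes> c) \<otimes> \<one> \<in> M"
    using assms(3) M by (auto simp: cl_def r_coset_def)
  obtain e where e: "e \<in> D" "inv (e \<otimes> c) \<otimes> x \<in> M"
    using assms(4) M by (auto simp: cl_def r_coset_def)
  have dc: "d \<in> carrier G" "e \<in> carrier G" using d e D.subset by blast+
  have "inv (inv (d \<otimes> c) \<otimes> \<one>) \<in> M" using d by blast
  then have "d \<otimes> c \<in> M" using dc assms(2) by simp
  then have "(d \<otimes> c) \<otimes> (inv (e \<otimes> c) \<otimes> x) \<in> M" using e by blast
  moreover have "(d \<otimes> c) \<otimes> (inv (e \<otimes> c) \<otimes> x) = inv (e \<otimes> inv d) \<otimes> x"
    using dc xc assms(2) by (simp add: inv_mult_group m_assoc inv_mult_cancel_left)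
  ultimately show "\<exists>y\<in>D. inv y \<otimes> x \<in> M" using d e by (metis D.m_closed D.m_inv_closed)
qed

text \<open>The covering by cosets replaces finite index because \<open>D\<close> is later a
  conjugate of \<open>H\<close>, which need not lie in \<open>H\<close>.\<close>

lemma base_Int_cl_subset:
  assumes "subgroup D G" "finite C" "C \<subseteq> carrier G" "H \<subseteq> (\<Union>c\<in>C. D #> c)"
  shows "\<exists>M\<in>\<B>. M \<inter> cl H \<subseteq> cl D"
proof -
  interpret D: subgroup D G by fact
  have "\<exists>M\<in>\<B>. \<forall>c\<in>C. M \<inter> cl (D #> c) \<subseteq> cl D"
  proof (rule finite_choice_base[OF assms(2)])
    fix c assume "c \<in> C"
    then have c: "c \<in> carrier G" using assms(3) by blast
    show "\<exists>M\<in>\<B>. M \<inter> cl (D #> c) \<subseteq> cl D"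
    proof (cases "\<one> \<in> cl (D #> c)")
      case True
      then show ?thesis using one_in_cl_coset[OF assms(1) c] base_nonempty by blast
    next
      case False
      then obtain M where M: "M \<in> \<B>" "\<forall>y\<in>D #> c. inv y \<otimes> \<one> \<notin> M" by (auto simp: cl_def)
      interpret M: subgroup M G by (rule base_subgroup[OF M(1)])
      \<comment> \<open>\<open>M\<close> is an open neighbourhood of the identity disjoint from the
        coset, hence also disjoint from its closure.\<close>
      have "x \<notin> cl (D #> c)" if x: "x \<in> M" for x
      proof
        assume "x \<in> cl (D #> c)"
        then obtain y where y: "y \<in> D #> c" "inv y \<otimes> x \<in> M" using M(1) by (auto simp: cl_def)
        then have "inv y \<otimes> x \<otimes> inv x \<in> M" using x by blast
        moreover have "y \<in> carrier G" using y r_coset_subset_G[OF D.subset c] by blast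
        moreover have "x \<in> carrier G" using x M.subset by blast
        ultimately have "inv y \<otimes> \<one> \<in> M" by (simp add: m_assoc)
        then show False using M(2) y by blast
      qed
      then show ?thesis using M(1) by blast
    qed
  qed blast
  then obtain M where M: "M \<in> \<B>" "\<forall>c\<in>C. M \<inter> cl (D #> c) \<subseteq> cl D" by blast
  have "M \<inter> cl H \<subseteq> cl D"
    using cl_mono[OF assms(4)] cl_Union[of "(\<lambda>c. D #> c) ` C"] assms(2) M(2) by fast
  with M(1) show ?thesis by blast
qed

end

section \<open>Normality tested on generators, and subgroups of finite index\<close>

text \<open>Inverses of generators get their own hypothesis, since a conjugate of an infinite
  \<open>R\<close> may be properly contained in \<open>R\<close>.\<close>

lemma (in group) normal_if_generators_conj:
  assumes gen: "generate G S = carrier G" and "S \<subseteq> carrier G" and R: "subgroup R G"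
    and conj: "\<And>s r. s \<in> S \<Longrightarrow> r \<in> R \<Longrightarrow> s \<otimes> r \<otimes> inv s \<in> R"
    and conj_inv: "\<And>s r. s \<in> S \<Longrightarrow> r \<in> R \<Longrightarrow> inv s \<otimes> r \<otimes> s \<in> R"
  shows "R \<lhd> G"
proof -
  interpret R: subgroup R G by fact
  have "\<forall>r\<in>R. g \<otimes> r \<otimes> inv g \<in> R" if "g \<in> generate G S" for g
    using that
  proof (induction g rule: generate.induct)
    case one
    then show ?case using R.subset by auto
  next
    case (incl h)
    then show ?case using conj by blast
  next
    case (inv h)
    then show ?case using conj_inv assms(2) by (metis inv_inv subsetD)
  next
    case (eng g h)
    have gh: "g \<in> carrier G" "h \<in> carrier G" using eng gen by auto
    show ?case
    proof
      fix r assume r: "r \<in> R"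
      then have "g \<otimes> (h \<otimes> r \<otimes> inv h) \<otimes> inv g \<in> R" using eng by blast
      moreover have "r \<in> carrier G" using r R.subset by blast
      ultimately show "g \<otimes> h \<otimes> r \<otimes> inv (g \<otimes> h) \<in> R"
        using gh by (simp add: inv_mult_group m_assoc)
    qed
  qed
  then show ?thesis using gen R by (simp add: normal_inv_iff)
qed

text \<open>A coset depends on the multiplication only, so restricting the carrier merely restricts
  the representatives.\<close>

lemma rcosets_carrier_update:
  "rcosets\<^bsub>G\<lparr>carrier := H\<rparr>\<^esub> K = (\<lambda>c. K #>\<^bsub>G\<^esub> c) ` H"
  by (auto simp: RCOSETS_def r_coset_def)

lemma (in group) finite_index_subgroup_reps:
  assumes "subgroup H G" "finite_index_subgroup K (G\<lparr>carrier := H\<rparr>)"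
  obtains C where "finite C" "C \<subseteq> H" "H = (\<Union>c\<in>C. K #> c)"
proof -
  interpret H: group "G\<lparr>carrier := H\<rparr>" using assms(1) subgroup_imp_group by blast
  have K: "subgroup K (G\<lparr>carrier := H\<rparr>)" using assms(2) by (simp add: finite_index_subgroup_def)
  have fin: "finite ((\<lambda>c. K #> c) ` H)"
    using assms(2) by (simp add: finite_index_subgroup_def rcosets_carrier_update)
  then obtain C where C: "C \<subseteq> H" "finite C" "(\<lambda>c. K #> c) ` H = (\<lambda>c. K #> c) ` C"
    by (meson finite_subset_image subset_refl)
  have "H = (\<Union>c\<in>H. K #> c)"
    using H.rcosets_part_G[OF K] by (simp add: rcosets_carrier_update)
  then have "H = (\<Union>c\<in>C. K #> c)" using C(3) by simp
  with C that show ?thesis by blast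
qed

text \<open>\<open>H\<close> is a union of finitely many translates of \<open>K\<close>.\<close>

lemma (in group) infinite_finite_index_subgroup:
  assumes "subgroup H G" "finite_index_subgroup K (G\<lparr>carrier := H\<rparr>)" "infinite H"
  shows "infinite K"
proof
  assume "finite K"
  then have "finite (K #> c)" for c by (simp add: r_coset_def)
  then show False using finite_index_subgroup_reps[OF assms(1,2)] assms(3) by (metis finite_UN)
qed

text \<open>Each coset of the intersection is a coset of \<open>K\<close> intersected with a coset
  of \<open>L\<close>, which leaves finitely many possibilities.\<close>

lemma (in group) finite_index_subgroup_Int:
  assumes "finite_index_subgroup K G" "finite_index_subgroup L G"
  shows "finite_index_subgroup (K \<inter> L) G"
proof -
  have K: "subgroup K G" and L: "subgroup L G"
    using assms by (auto simp: finite_index_subgroup_def)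
  have "(K \<inter> L) #> x = (K #> x) \<inter> (L #> x)" if "x \<in> carrier G" for x
  proof
    show "(K #> x) \<inter> (L #> x) \<subseteq> (K \<inter> L) #> x"
      using that subgroup.mem_carrier[OF K] subgroup.mem_carrier[OF L]
      by (force simp: r_coset_def)
  qed (auto simp: r_coset_def)
  then have "rcosets (K \<inter> L) \<subseteq> (\<lambda>(A, B). A \<inter> B) ` ((rcosets K) \<times> (rcosets L))"
    by (fastforce simp: RCOSETS_def)
  moreover have "finite ((\<lambda>(A, B). A \<inter> B) ` ((rcosets K) \<times> (rcosets L)))"
    using assms by (simp add: finite_index_subgroup_def)
  ultimately show ?thesis
    using subgroups_Inter_pair[OF K L] finite_subset by (auto simp: finite_index_subgroup_def)
qed

lemma (in group) normal_filter_base_normal_virtually_containing: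
  assumes "subgroup H G"
  shows "normal_filter_base G (normal_virtually_containing G H)"
proof (intro normal_filter_base.intro normal_filter_base_axioms.intro group_axioms)
  interpret H: group "G\<lparr>carrier := H\<rparr>" using assms subgroup_imp_group by blast
  show "M \<lhd> G" if "M \<in> normal_virtually_containing G H" for M
    using that by (simp add: normal_virtually_containing_def)
  \<comment> \<open>\<open>H\<close> has index one in itself, so \<open>carrier G\<close> belongs to
    the base.\<close>
  have "rcosets\<^bsub>G\<lparr>carrier := H\<rparr>\<^esub> H \<subseteq> {H}"
    using H.coset_join2[OF _ H.subgroup_self] by (auto simp: RCOSETS_def)
  then have "finite_index_subgroup H (G\<lparr>carrier := H\<rparr>)"
    using H.subgroup_self finite_subset by (fastforce simp: finite_index_subgroup_def)
  moreover have "carrier G \<lhd> G" by (simp add: normal_inv_iff subgroup_self)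
  ultimately show "normal_virtually_containing G H \<noteq> {}"
    using subgroup.subset[OF assms] by (auto simp: normal_virtually_containing_def)
  fix M M' assume "M \<in> normal_virtually_containing G H" "M' \<in> normal_virtually_containing G H"
  moreover have "M \<inter> M' \<lhd> G" if "M \<lhd> G" "M' \<lhd> G"
    using that subgroups_Inter_pair by (auto simp: normal_inv_iff)
  ultimately show "M \<inter> M' \<in> normal_virtually_containing G H"
    using H.finite_index_subgroup_Int by (fastforce simp: normal_virtually_containing_def)
qed

section \<open>Conjugation and commensurated subgroups\<close>

lemma (in group) conj_set_eq:
  "g <# H #> inv g = (\<lambda>h. g \<otimes> h \<otimes> inv g) ` H"
  by (auto simp: l_coset_def r_coset_def)

text \<open>For k in the intersection of H and n H n^-1, the commutator n^-1 k^-1 n k lies in H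
  because n^-1 k n does, and in N by normality. So such k yield only finitely many conjugates of n,
  and finitely many coset representatives account for the rest of H.\<close>

lemma (in group) finite_conjugates_commensurated:
  assumes "commensurated H G" "N \<lhd> G" "finite (H \<inter> N)" "n \<in> N"
  shows "finite ((\<lambda>h. inv h \<otimes> n \<otimes> h) ` H)"
proof -
  interpret N: normal N G by fact
  have H: "subgroup H G" using assms(1) by (simp add: commensurated_def)
  interpret H: subgroup H G by fact
  have nc: "n \<in> carrier G" using assms(4) N.subset by blast
  define K where "K = H \<inter> (n <# H #> inv n)"
  have fK: "finite_index_subgroup K (G\<lparr>carrier := H\<rparr>)"
    using assms(1) nc by (simp add: commensurated_def K_def)
  obtain C where C: "finite C" "C \<subseteq> H" "H = (\<Union>c\<in>C. K #> c)"
    using finite_index_subgroup_reps[OF H fK] by blast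
  have "(\<lambda>h. inv h \<otimes> n \<otimes> h) ` H \<subseteq> (\<lambda>(c, z). inv c \<otimes> (n \<otimes> z) \<otimes> c) ` (C \<times> (H \<inter> N))"
  proof (rule image_subsetI)
    fix h assume "h \<in> H"
    then obtain c k where c: "c \<in> C" and k: "k \<in> K" and h: "h = k \<otimes> c"
      using C(3) by (auto simp: r_coset_def)
    obtain k' where k': "k' \<in> H" "k = n \<otimes> k' \<otimes> inv n"
      using k by (auto simp: K_def conj_set_eq)
    have kH: "k \<in> H" using k by (simp add: K_def)
    have cc: "c \<in> carrier G" "k \<in> carrier G" "k' \<in> carrier G"
      using c C(2) kH k'(1) H.subset by auto
    define z where "z = inv n \<otimes> (inv k \<otimes> n \<otimes> k)"
    have "z = inv k' \<otimes> k"
      unfolding z_def using nc cc(3) by (simp add: k'(2) inv_mult_group m_assoc inv_mult_cancel_left)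
    then have "z \<in> H" using kH k'(1) by simp
    moreover have "z \<in> N"
      unfolding z_def using N.inv_op_closed1[OF cc(2) assms(4)] assms(4) by simp
    moreover have "inv h \<otimes> n \<otimes> h = inv c \<otimes> (n \<otimes> z) \<otimes> c"
      unfolding h z_def using cc nc by (simp add: inv_mult_group m_assoc inv_mult_cancel_left)
    ultimately show "inv h \<otimes> n \<otimes> h \<in> (\<lambda>(c, z). inv c \<otimes> (n \<otimes> z) \<otimes> c) ` (C \<times> (H \<inter> N))"
      using c by force
  qed
  then show ?thesis using C(1) assms(3) finite_subset by blast
qed

lemma (in group) normal_base_Int_cl:
  assumes "finitely_generated_group G" "commensurated H G" "normal_filter_base G \<B>"
  shows "\<exists>M\<in>\<B>. M \<inter> normal_filter_base.cl G \<B> H \<lhd> G"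
proof -
  interpret normal_filter_base G \<B> by fact
  have H: "subgroup H G" using assms(2) by (simp add: commensurated_def)
  interpret H: subgroup H G by fact
  interpret clH: subgroup "cl H" G by (rule cl_subgroup[OF H])
  obtain S where S: "finite S" "S \<subseteq> carrier G" "generate G S = carrier G"
    using assms(1) by (auto simp: finitely_generated_group_def)
  \<comment> \<open>Inverses are included so that the same \<open>M\<close> handles conjugation by s
    and by s^-1.\<close>
  have "\<exists>M\<in>\<B>. \<forall>s\<in>S \<union> m_inv G ` S. M \<inter> cl H \<subseteq> cl (s <# H #> inv s)"
  proof (rule finite_choice_base)
    show "finite (S \<union> m_inv G ` S)" using S by simp
    fix s assume "s \<in> S \<union> m_inv G ` S"
    then have s: "s \<in> carrier G" using S by auto
    define D where "D = s <# H #> inv s"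
    have D: "subgroup D G"
      unfolding D_def using subgroup_conjugation_is_surj2 s H by blast
    have fK: "finite_index_subgroup (H \<inter> D) (G\<lparr>carrier := H\<rparr>)"
      using assms(2) s by (simp add: commensurated_def D_def)
    obtain C where C: "finite C" "C \<subseteq> H" "H = (\<Union>c\<in>C. (H \<inter> D) #> c)"
      using finite_index_subgroup_reps[OF H fK] by blast
    have "(\<Union>c\<in>C. (H \<inter> D) #> c) \<subseteq> (\<Union>c\<in>C. D #> c)" by (auto simp: r_coset_def)
    then have "H \<subseteq> (\<Union>c\<in>C. D #> c)" using C(3) by simp
    moreover have "C \<subseteq> carrier G" using C(2) H.subset by blast
    ultimately show "\<exists>M\<in>\<B>. M \<inter> cl H \<subseteq> cl (s <# H #> inv s)"
      using base_Int_cl_subset[OF D C(1)] D_def by simp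
  qed blast
  then obtain M where M: "M \<in> \<B>"
    and Ms: "\<And>s. s \<in> S \<union> m_inv G ` S \<Longrightarrow> M \<inter> cl H \<subseteq> cl (s <# H #> inv s)"
    by blast
  interpret M: normal M G by (rule base_normal[OF M])
  \<comment> \<open>Conjugating by s^-1 carries the closure of s H s^-1 back into the closure of
    \<open>H\<close>, while \<open>M\<close> is preserved by normality.\<close>
  have conj: "inv s \<otimes> r \<otimes> s \<in> M \<inter> cl H" if s: "s \<in> S \<union> m_inv G ` S" and r: "r \<in> M \<inter> cl H" for s r
  proof -
    have sc: "s \<in> carrier G" using s S by auto
    have "s <# H #> inv s \<subseteq> carrier G" using sc H.subset by (auto simp: conj_set_eq)
    moreover have "r \<in> cl (s <# H #> inv s)" using Ms[OF s] r by blast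
    ultimately have "inv s \<otimes> r \<otimes> inv (inv s) \<in> cl ((\<lambda>y. inv s \<otimes> y \<otimes> inv (inv s)) ` (s <# H #> inv s))"
      using cl_conj sc by blast
    moreover have "(\<lambda>y. inv s \<otimes> y \<otimes> inv (inv s)) ` (s <# H #> inv s) \<subseteq> H"
    proof -
      have "inv s \<otimes> (s \<otimes> h \<otimes> inv s) \<otimes> s = h" if "h \<in> H" for h
        using sc H.mem_carrier[OF that] by (simp add: m_assoc inv_mult_cancel_left)
      then show ?thesis using sc by (auto simp: conj_set_eq)
    qed
    ultimately have "inv s \<otimes> r \<otimes> inv (inv s) \<in> cl H"
      by (meson cl_mono subsetD)
    then have "inv s \<otimes> r \<otimes> s \<in> cl H" using sc by simp
    moreover have "inv s \<otimes> r \<otimes> s \<in> M" using M.inv_op_closed1[OF sc] r by blast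
    ultimately show ?thesis by blast
  qed
  have "M \<inter> cl H \<lhd> G"
  proof (rule normal_if_generators_conj[OF S(3,2)])
    show "subgroup (M \<inter> cl H) G"
      using subgroups_Inter_pair M.subgroup_axioms clH.subgroup_axioms by blast
    show "s \<otimes> r \<otimes> inv s \<in> M \<inter> cl H" if "s \<in> S" "r \<in> M \<inter> cl H" for s r
      using conj[of "inv s" r] that S(2) by auto
    show "inv s \<otimes> r \<otimes> s \<in> M \<inter> cl H" if "s \<in> S" "r \<in> M \<inter> cl H" for s r
      using conj that by blast
  qed
  with M show ?thesis by blast
qed

section \<open>Normal subgroups with finite intersection with a commensurated subgroup\<close>

theorem corollary21:
  fixes G :: "('a, 'b) monoid_scheme" (structure)
  assumes "finitely_generated_group G"
    and "\<And>N. N \<lhd> G \<Longrightarrow> infinite N \<Longrightarrow> centralizer G N = {\<one>}"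
  shows "\<forall>H. infinite H \<and> commensurated H G \<and> relatively_residually_finite H G \<longrightarrow>
           (\<forall>N. N \<lhd> G \<and> N \<noteq> {\<one>} \<longrightarrow> infinite (H \<inter> N))"
proof (intro allI impI, elim conjE)
  interpret group G using assms(1) by (simp add: finitely_generated_group_def)
  fix H N
  assume H: "infinite H" "commensurated H G" "relatively_residually_finite H G"
    and N: "N \<lhd> G" "N \<noteq> {\<one>}"
  interpret N: normal N G by fact
  have sH: "subgroup H G" using H(2) by (simp add: commensurated_def)
  interpret H: subgroup H G by fact
  define \<B> where "\<B> = normal_virtually_containing G H"
  have \<B>: "normal_filter_base G \<B>"
    unfolding \<B>_def by (rule normal_filter_base_normal_virtually_containing[OF sH])
  interpret normal_filter_base G \<B> by fact
  have Int\<B>: "\<Inter>\<B> = {\<one>}"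
    using H(3) by (simp add: relatively_residually_finite_def \<B>_def)
  obtain M where M: "M \<in> \<B>" "M \<inter> cl H \<lhd> G"
    using normal_base_Int_cl[OF assms(1) H(2) \<B>] by blast
  show "infinite (H \<inter> N)"
  proof
    assume fin: "finite (H \<inter> N)"
    have "n = \<one>" if n: "n \<in> N" for n
    proof -
      have nc: "n \<in> carrier G" using n N.subset by blast
      define X where "X = (\<lambda>h. inv h \<otimes> n \<otimes> h) ` H"
      have X: "finite X" "X \<subseteq> carrier G"
        using finite_conjugates_commensurated[OF H(2) N(1) fin n] nc H.subset
        by (auto simp: X_def)
      have conj_X: "inv x \<otimes> n \<otimes> x \<in> X" if "x \<in> cl H" for x
        using conj_by_cl[OF H.subset nc that] cl_finite[OF Int\<B> X] by (simp add: X_def)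
      \<comment> \<open>The elements \<open>inv n \<otimes> x\<close> are the finitely many
        commutators of \<open>n\<close> with \<open>cl H\<close>. Each one other than the identity
        is missed by some member of the base, as \<open>\<Inter>\<B>\<close> is trivial.\<close>
      have "\<exists>M'\<in>\<B>. \<forall>x\<in>X. inv n \<otimes> x \<in> M' \<longrightarrow> inv n \<otimes> x = \<one>"
      proof (rule finite_choice_base[OF X(1)])
        show "\<exists>M'\<in>\<B>. inv n \<otimes> x \<in> M' \<longrightarrow> inv n \<otimes> x = \<one>" for x
          using Int\<B> base_nonempty by blast
      qed blast
      then obtain M' where M': "M' \<in> \<B>"
        and triv: "\<And>x. x \<in> X \<Longrightarrow> inv n \<otimes> x \<in> M' \<Longrightarrow> inv n \<otimes> x = \<one>"
        by blast
      define R where "R = M' \<inter> (M \<inter> cl H)"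
      interpret M': normal M' G by (rule base_normal[OF M'])
      have R: "R \<lhd> G"
        using base_normal[OF M'] M(2) subgroups_Inter_pair by (auto simp: R_def normal_inv_iff)
      have "infinite R"
      proof -
        \<comment> \<open>Membership in the base supplies a finite index subgroup of the infinite
          group \<open>H\<close> inside \<open>R\<close>.\<close>
        have "M' \<inter> M \<in> \<B>" using base_Int M' M(1) by blast
        then obtain K where K: "finite_index_subgroup K (G\<lparr>carrier := H\<rparr>)" "K \<subseteq> M' \<inter> M"
          by (auto simp: \<B>_def normal_virtually_containing_def)
        have "K \<subseteq> H"
          using K(1) subgroup.subset by (fastforce simp: finite_index_subgroup_def)
        then have "K \<subseteq> R" using K(2) subset_cl[OF H.subset] by (auto simp: R_def)
        then show ?thesis
          using infinite_finite_index_subgroup[OF sH K(1) H(1)] finite_subset by blast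
      qed
      moreover have "n \<otimes> r = r \<otimes> n" if r: "r \<in> R" for r
      proof -
        have rM: "r \<in> M'" and rH: "r \<in> cl H" using r by (auto simp: R_def)
        have rc: "r \<in> carrier G" using rM M'.subset by blast
        \<comment> \<open>The commutator is the product of a conjugate of r^-1 with r, so it lies in
          the normal subgroup \<open>M'\<close> and must be the identity by
          \<open>triv\<close>.\<close>
        have "inv n \<otimes> inv r \<otimes> n \<otimes> r \<in> M'" using M'.inv_op_closed1[OF nc] rM by simp
        then have "inv n \<otimes> (inv r \<otimes> n \<otimes> r) \<in> M'" using nc rc by (simp add: m_assoc)
        then have "inv n \<otimes> (inv r \<otimes> n \<otimes> r) = \<one>" using triv conj_X[OF rH] by blast
        then have "inv r \<otimes> (n \<otimes> r) = n"
          using nc rc by (metis inv_closed inv_solve_left m_assoc m_closed r_one)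
        then show ?thesis using nc rc by (metis inv_solve_left m_closed)
      qed
      then have "n \<in> centralizer G R" using nc by (simp add: centralizer_def)
      ultimately show ?thesis using assms(2)[OF R] by simp
    qed
    then show False using N(2) N.one_closed by blast
  qed
qed

end
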